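(* Let $S=\{(x_1,y_1),\dots,(x_m,y_m)\}\subset\mathbb{R}^{n_0}\times\mathbb{R}^{d_y}$ be any dataset (no assumption is made on how it was generated) and let $\mathbb{P}_{(X,Y)}$ be any probability distribution on $\mathbb{R}^{n_0}\times\mathbb{R}^{d_y}$ for which the expectations below are finite. Consider a feedforward DAG network with ReLU and/or max-pooling nonlinearities, with network outputs $z_k^{[L]}(x,w)$, $k=1,\dots,d_y$, and with path quantities $\bar x,\bar\sigma(x,w),\bar w_k$ as defined in the context. Let $w^S$ be the (arbitrary) parameter vector obtained by learning with $S$, with corresponding path weights $\bar w_k^S$. Let $z=\bar x\circ\bar\sigma(x,w^S)$, $z_i=\bar x_i\circ\bar\sigma(x_i,w^S)$, $$G=\mathbb{E}_{(x,y)\sim\mathbb{P}_{(X,Y)}}[zz^\top]-\frac1m\sum_{i=1}^m z_iz_i^\top,\qquad v_k=\frac1m\sum_{i=1}^m y_{ik}z_i-\mathbb{E}_{(x,y)\sim\mathbb{P}_{(X,Y)}}[y_kz]\quad(k=1,\dots,d_y),$$ and $c_y=\mathbb{E}_y[\|y\|_2^2]-\frac1m\sum_{i=1}^m\|y_i\|_2^2$. Let $\{\lambda_j\}_j$ and $\{u_j\}_j$ be the eigenvalues and a corresponding orthonormal set of eigenvectors of $G$. Let $\theta^{(1)}_{\bar w_k^S,j}$ be the angle between $u_j$ and $\bar w_k^S$, and let $\theta^{(2)}_{\bar w_k^S}$ be the angle between $v_k$ and $\bar w_k^S$. Then, for the squared loss, deterministically, $$\mathcal{R}[w^S]-\mathcal{R}_S[w^S]-c_y=\sum_{k=1}^{d_y}\Big(2\|v_k\|_2\|\bar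 w_k^S\|_2\cos\theta^{(2)}_{\bar w_k^S}+\|\bar w_k^S\|_2^2\sum_j\lambda_j\cos^2\theta^{(1)}_{\bar w_k^S,j}\Big)$$ $$\le\sum_{k=1}^{d_y}\Big(2\|v_k\|_2\|\bar w_k^S\|_2+\lambda_{\max}(G)\|\bar w_k^S\|_2^2\Big).$$
   Context: Network. The network has layers $0,1,\dots,L$ of widths $n_0,\dots,n_L$ with $n_L=d_y$. Its pre-activations are $z^{[l]}(x,w)=\sum_{l'=0}^{l-1}W^{(l,l')}\sigma^{[l']}(z^{[l']}(x,w))$ for $l=1,\dots,L$, with the boundary convention $\sigma^{[0]}(z^{[0]}(x,w))\equiv x$. Here $W^{(l,l')}\in\mathbb{R}^{n_l\times n_{l'}}$ are weight matrices (of any structure, e.g. sparse or with shared entries) determined by the trainable parameter vector $w$. The nonlinearities $\sigma^{[l]}$ (ReLU and/or max pooling) satisfy $\sigma^{[l]}(z^{[l]}(x,w))=\dot\sigma^{[l]}(x,w)\circ z^{[l]}(x,w)$ for a vector $\dot\sigma^{[l]}(x,w)\in\{0,1\}^{n_l}$, where $\circ$ is the entrywise product. The network output is $z^{[L]}(x,w)\in\mathbb{R}^{d_y}$. Paths. A path index $j$ is a choice of layers $0=l_0<l_1<\dots<l_h<L$ ($h\ge0$) and of a unit $i_s\in\{1,\dots,n_{l_s}\}$ in each of these layers; it represents the path from input unit $i_0$ through the units $i_1,\dots,i_h$ to the $k$-th output unit. Define $\bar x_j=x_{i_0}$, $\bar\sigma_j(x,w)=\prod_{s=1}^h\dot\sigma^{[l_s]}_{i_s}(x,w)\in\{0,1\}$,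 and $\bar w_{k,j}=W^{(L,l_h)}_{k i_h}\prod_{s=1}^hW^{(l_s,l_{s-1})}_{i_s i_{s-1}}$. Let $\bar x$, $\bar\sigma(x,w)$, $\bar w_k$ be the vectors with these entries, indexed by all paths; $\bar x_i$ denotes the vector $\bar x$ built from the input $x_i$. Then $z_k^{[L]}(x,w)=[\bar x\circ\bar\sigma(x,w)]^\top\bar w_k$ for each $k$. Risks (squared loss). $\mathcal{R}[w]=\mathbb{E}_{(x,y)\sim\mathbb{P}_{(X,Y)}}\big[\sum_{k=1}^{d_y}(z_k^{[L]}(x,w)-y_k)^2\big]$ and $\mathcal{R}_S[w]=\frac1m\sum_{i=1}^m\sum_{k=1}^{d_y}(z_k^{[L]}(x_i,w)-y_{ik})^2$. $\lambda_{\max}(G)$ is the largest eigenvalue of the symmetric matrix $G$. If one of the vectors defining an angle is zero, the corresponding angle is arbitrary (the term in which it appears is zero). *)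

theory Defs
  imports
    "HOL-Probability.Probability"
    "Jordan_Normal_Form.Spectral_Radius"
begin

unbundle no vec_syntax
unbundle no inner_syntax

text \<open>Layer \<open>l\<close> has units \<open>0, \<dots>, n l - 1\<close>, data points are indexed by \<open>0, \<dots>, m - 1\<close> and
  outputs by \<open>0, \<dots>, n L - 1\<close>. Vectors and matrices are those of \<^theory>\<open>Jordan_Normal_Form.Matrix\<close>.\<close>

subsection \<open>Vectors\<close>

definition l2_norm :: "real vec \<Rightarrow> real" where
  "l2_norm v = sqrt (v \<bullet> v)"

definition hadamard :: "real vec \<Rightarrow> real vec \<Rightarrow> real vec" (infixl "\<circ>\<^sub>v" 75) where
  "u \<circ>\<^sub>v v = vec (dim_vec v) (\<lambda>i. u $ i * v $ i)"

text \<open>If one of the vectors is zero, every real number counts as an angle between them.\<close>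

definition is_angle :: "real \<Rightarrow> real vec \<Rightarrow> real vec \<Rightarrow> bool" where
  "is_angle \<theta> u v \<longleftrightarrow>
     (u \<noteq> 0\<^sub>v (dim_vec u) \<and> v \<noteq> 0\<^sub>v (dim_vec v) \<longrightarrow>
        \<theta> = arccos ((u \<bullet> v) / (l2_norm u * l2_norm v)))"

text \<open>As many orthonormal eigenvectors as the dimension, so that \<open>\<mu> 0, \<mu> 1, \<dots>\<close> lists all
  eigenvalues, with multiplicity.\<close>

definition orthonormal_eigensystem ::
  "real mat \<Rightarrow> (nat \<Rightarrow> real) \<Rightarrow> (nat \<Rightarrow> real vec) \<Rightarrow> bool" where
  "orthonormal_eigensystem A \<mu> u \<longleftrightarrow>
     (\<forall>j<dim_row A. eigenvector A (u j) (\<mu> j)) \<and>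
     (\<forall>i<dim_row A. \<forall>j<dim_row A. u i \<bullet> u j = (if i = j then 1 else 0))"

definition lambda_max :: "real mat \<Rightarrow> real" where
  "lambda_max A = Max (spectrum A)"

text \<open>The Borel \<open>\<sigma>\<close>-algebra of \<open>\<real>\<^sup>d\<close>, transported to vectors of dimension \<open>d\<close>.\<close>

definition borel_vec :: "nat \<Rightarrow> real vec measure" where
  "borel_vec d =
     vimage_algebra (carrier_vec d) (\<lambda>v. \<lambda>i\<in>{..<d}. v $ i) (Pi\<^sub>M {..<d} (\<lambda>_. borel))"

subsection \<open>The network\<close>

text \<open>Max pooling keeps the dimension: in each pool of units, one maximal entry, chosen by the
  tie-breaking rule \<open>sel\<close>, is passed on, and the other entries are replaced by zero. The units
  for which \<open>rect\<close> holds are rectified. Pools are arbitrary, possibly singletons; hence this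
  covers ReLU (singleton pools, everything rectified), max pooling (nothing rectified) and
  combinations of the two.\<close>

definition relu_max_pooling :: "nat \<Rightarrow> (real vec \<Rightarrow> real vec) \<Rightarrow> bool" where
  "relu_max_pooling d f \<longleftrightarrow>
     (\<exists>(pools :: nat set set) (rect :: nat \<Rightarrow> bool) (sel :: real vec \<Rightarrow> nat set \<Rightarrow> nat).
        partition_on {..<d} pools \<and>
        (\<forall>v\<in>carrier_vec d.
           (\<forall>B\<in>pools. sel v B \<in> B \<and> (\<forall>i\<in>B. v $ i \<le> v $ sel v B)) \<and>
           f v = vec d (\<lambda>i.
             if \<exists>B\<in>pools. i = sel v B then (if rect i then max 0 (v $ i) else v $ i) else 0)))"

text \<open>\<open>W l l' w\<close> is the matrix of the weights from layer \<open>l'\<close> to layer \<open>l\<close> for the parameter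
  vector \<open>w\<close>, and \<open>preact n W \<sigma> x w l\<close> is the vector of pre-activations of layer \<open>l\<close>
  (relevant for \<open>l > 0\<close> only).\<close>

fun preact :: "(nat \<Rightarrow> nat) \<Rightarrow> (nat \<Rightarrow> nat \<Rightarrow> real vec \<Rightarrow> real mat) \<Rightarrow> (nat \<Rightarrow> real vec \<Rightarrow> real vec) \<Rightarrow>
    real vec \<Rightarrow> real vec \<Rightarrow> nat \<Rightarrow> real vec" where
  "preact n W \<sigma> x w l =
     vec (n l) (\<lambda>i. \<Sum>l'<l.
       (W l l' w *\<^sub>v (if l' = 0 then x else \<sigma> l' (preact n W \<sigma> x w l'))) $ i)"

declare preact.simps [simp del]

text \<open>\<open>\<sigma>' l x w\<close> is the 0-1 vector of gates of layer \<open>l\<close>; the condition leaves it free at units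
  with pre-activation zero.\<close>

definition dag_network ::
  "nat \<Rightarrow> (nat \<Rightarrow> nat) \<Rightarrow> nat \<Rightarrow> (nat \<Rightarrow> nat \<Rightarrow> real vec \<Rightarrow> real mat) \<Rightarrow> (nat \<Rightarrow> real vec \<Rightarrow> real vec) \<Rightarrow>
     (nat \<Rightarrow> real vec \<Rightarrow> real vec \<Rightarrow> real vec) \<Rightarrow> bool" where
  "dag_network L n q W \<sigma> \<sigma>' \<longleftrightarrow>
     0 < L \<and>
     (\<forall>l\<le>L. \<forall>l'<l. \<forall>w\<in>carrier_vec q. W l l' w \<in> carrier_mat (n l) (n l')) \<and>
     (\<forall>l\<in>{1..<L}. relu_max_pooling (n l) (\<sigma> l)) \<and>
     (\<forall>l\<in>{1..<L}. \<forall>x\<in>carrier_vec (n 0). \<forall>w\<in>carrier_vec q.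
        \<sigma>' l x w \<in> carrier_vec (n l) \<and>
        (\<forall>i<n l. \<sigma>' l x w $ i \<in> {0, 1}) \<and>
        \<sigma> l (preact n W \<sigma> x w l) = \<sigma>' l x w \<circ>\<^sub>v preact n W \<sigma> x w l)"

subsection \<open>Paths\<close>

text \<open>A path is the list \<open>[(l\<^sub>0, i\<^sub>0), \<dots>, (l\<^sub>h, i\<^sub>h)]\<close> of its units before the output unit.\<close>

definition paths :: "nat \<Rightarrow> (nat \<Rightarrow> nat) \<Rightarrow> (nat \<times> nat) list set" where
  "paths L n =
     {p. p \<noteq> [] \<and> fst (hd p) = 0 \<and> sorted_wrt (<) (map fst p) \<and>
         (\<forall>(l, i)\<in>set p. l < L \<and> i < n l)}"

text \<open>The order in which the paths index the entries of a vector is an arbitrary fixed one.\<close>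

definition path_list :: "nat \<Rightarrow> (nat \<Rightarrow> nat) \<Rightarrow> (nat \<times> nat) list list" where
  "path_list L n = (SOME ps. distinct ps \<and> set ps = paths L n)"

lemma finite_paths: "finite (paths L n)"
proof (rule finite_subset)
  let ?A = "Sigma {..<L} (\<lambda>l. {..<n l})"
  show "paths L n \<subseteq> {p. set p \<subseteq> ?A \<and> distinct p}"
  proof
    fix p assume p: "p \<in> paths L n"
    then have "sorted_wrt (<) (map fst p)" and "set p \<subseteq> ?A"
      by (auto simp: paths_def)
    then have "distinct (map fst p)"
      by (simp add: strict_sorted_iff)
    with \<open>set p \<subseteq> ?A\<close> show "p \<in> {p. set p \<subseteq> ?A \<and> distinct p}"
      by (simp add: distinct_map)
  qed
  show "finite {p. set p \<subseteq> ?A \<and> distinct p}"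
    by (intro finite_subset_distinct) auto
qed

lemma
  shows distinct_path_list: "distinct (path_list L n)"
    and set_path_list: "set (path_list L n) = paths L n"
proof -
  have "\<exists>ps. distinct ps \<and> set ps = paths L n"
    using finite_distinct_list[OF finite_paths] by blast
  then have "distinct (path_list L n) \<and> set (path_list L n) = paths L n"
    unfolding path_list_def by (rule someI_ex)
  then show "distinct (path_list L n)" and "set (path_list L n) = paths L n"
    by auto
qed

definition path_inputs :: "nat \<Rightarrow> (nat \<Rightarrow> nat) \<Rightarrow> real vec \<Rightarrow> real vec" where
  "path_inputs L n x =
     vec (length (path_list L n)) (\<lambda>j. let p = path_list L n ! j in x $ snd (hd p))"

definition path_gates ::
  "nat \<Rightarrow> (nat \<Rightarrow> nat) \<Rightarrow> (nat \<Rightarrow> real vec \<Rightarrow> real vec \<Rightarrow> real vec) \<Rightarrow> real vec \<Rightarrow> real vec \<Rightarrow> real vec" where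
  "path_gates L n \<sigma>' x w =
     vec (length (path_list L n)) (\<lambda>j. let p = path_list L n ! j in
       \<Prod>s = 1..<length p. \<sigma>' (fst (p ! s)) x w $ snd (p ! s))"

definition path_weights ::
  "nat \<Rightarrow> (nat \<Rightarrow> nat) \<Rightarrow> (nat \<Rightarrow> nat \<Rightarrow> real vec \<Rightarrow> real mat) \<Rightarrow> real vec \<Rightarrow> nat \<Rightarrow> real vec" where
  "path_weights L n W w k =
     vec (length (path_list L n)) (\<lambda>j. let p = path_list L n ! j in
       W L (fst (last p)) w $$ (k, snd (last p)) *
       (\<Prod>s = 1..<length p.
          W (fst (p ! s)) (fst (p ! (s - 1))) w $$ (snd (p ! s), snd (p ! (s - 1)))))"

subsection \<open>Risks\<close>

text \<open>Here \<open>f\<close> is the function computed by the network, with \<open>d\<close> outputs.\<close>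

definition risk :: "(real vec \<times> real vec) measure \<Rightarrow> nat \<Rightarrow> (real vec \<Rightarrow> real vec) \<Rightarrow> real" where
  "risk P d f = (LINT (x, y)|P. (\<Sum>k<d. (f x $ k - y $ k)\<^sup>2))"

definition empirical_risk ::
  "nat \<Rightarrow> (nat \<Rightarrow> real vec) \<Rightarrow> (nat \<Rightarrow> real vec) \<Rightarrow> nat \<Rightarrow> (real vec \<Rightarrow> real vec) \<Rightarrow> real" where
  "empirical_risk m xs ys d f = (1 / real m) * (\<Sum>i<m. \<Sum>k<d. (f (xs i) $ k - ys i $ k)\<^sup>2)"

end

theory Submission
  imports Defs
begin

text \<open>Sorting the paths into a unit by their last edge turns the recursion for the pre-activations into
  the path expansion \<open>net x $ k = z x \<bullet> wbar k\<close>, so the squared loss is a quadratic polynomial in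
  \<open>wbar k\<close> whose coefficients are products of entries of \<open>z x\<close> and \<open>y\<close>. The weights are the same in
  the expected and in the empirical risk; hence the difference of the risks, up to the constant
  \<open>c_y\<close>, is the sum over \<open>k\<close> of \<open>2 * (v k \<bullet> wbar k) + wbar k \<bullet> (G *\<^sub>v wbar k)\<close>. Expanding in an
  orthonormal eigenbasis gives the equality. The bound is the Cauchy-Schwarz inequality together with the
  fact that the maximum of the Rayleigh quotient of a symmetric matrix is an eigenvalue.\<close>

section \<open>Path expansion of the pre-activations\<close>

lemma scalar_prod_eq_sum: "v \<in> carrier_vec N \<Longrightarrow> u \<bullet> v = (\<Sum>a<N. u $ a * v $ a)"
  by (auto simp: scalar_prod_def lessThan_atLeast0)

text \<open>The contribution of the path \<open>p\<close> to the pre-activation of unit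
  \<open>i\<close> in layer \<open>l\<close>. The target is arbitrary, not only an output unit, so
  that an induction over the layers is possible; the factors are grouped as in
  \<open>path_inputs\<close>, \<open>path_gates\<close> and \<open>path_weights\<close>.\<close>

definition path_value ::
  "(nat \<Rightarrow> nat \<Rightarrow> real vec \<Rightarrow> real mat) \<Rightarrow> (nat \<Rightarrow> real vec \<Rightarrow> real vec \<Rightarrow> real vec) \<Rightarrow>
     real vec \<Rightarrow> real vec \<Rightarrow> nat \<Rightarrow> nat \<Rightarrow> (nat \<times> nat) list \<Rightarrow> real" where
  "path_value W \<sigma>' x w l i p =
     x $ snd (hd p) * (\<Prod>s = 1..<length p. \<sigma>' (fst (p ! s)) x w $ snd (p ! s)) *
     (W l (fst (last p)) w $$ (i, snd (last p)) *
       (\<Prod>s = 1..<length p.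
          W (fst (p ! s)) (fst (p ! (s - 1))) w $$ (snd (p ! s), snd (p ! (s - 1)))))"

lemma path_value_singleton: "path_value W \<sigma>' x w l i [(l', j)] = W l l' w $$ (i, j) * x $ j"
  by (simp add: path_value_def)

text \<open>The edge from the last unit of \<open>p\<close> now leads into \<open>(l', j)\<close>,
  and the longer path gains one gate and one edge. For nonempty \<open>p\<close> the unit
  \<open>(l', j)\<close> is not the input unit, which carries no gate.\<close>

lemma path_value_snoc:
  assumes "p \<noteq> []"
  shows "path_value W \<sigma>' x w l i (p @ [(l', j)]) =
    W l l' w $$ (i, j) * (\<sigma>' l' x w $ j * path_value W \<sigma>' x w l' j p)"
proof -
  let ?p = "p @ [(l', j)]"
  \<comment> \<open>Gates and weights are both products of a function of a unit and its predecessor,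
    so one splitting of the last factor serves both.\<close>
  have split: "(\<Prod>s = 1..<length ?p. f (?p ! s) (?p ! (s - 1))) =
      (\<Prod>s = 1..<length p. f (p ! s) (p ! (s - 1))) * f (l', j) (last p)"
    for f :: "nat \<times> nat \<Rightarrow> nat \<times> nat \<Rightarrow> real"
  proof -
    have "(\<Prod>s = 1..<length ?p. f (?p ! s) (?p ! (s - 1))) =
        (\<Prod>s = 1..<length p. f (?p ! s) (?p ! (s - 1))) *
        f (?p ! length p) (?p ! (length p - 1))"
      using assms by (simp add: Suc_le_eq)
    also have "(\<Prod>s = 1..<length p. f (?p ! s) (?p ! (s - 1))) =
        (\<Prod>s = 1..<length p. f (p ! s) (p ! (s - 1)))"
      by (intro prod.cong) (auto simp: nth_append)
    finally show ?thesis
      using assms by (simp add: nth_append last_conv_nth)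
  qed
  have gates: "(\<Prod>s = 1..<length ?p. \<sigma>' (fst (?p ! s)) x w $ snd (?p ! s)) =
      (\<Prod>s = 1..<length p. \<sigma>' (fst (p ! s)) x w $ snd (p ! s)) * \<sigma>' l' x w $ j"
    using split[of "\<lambda>a b. \<sigma>' (fst a) x w $ snd a"] by simp
  have weights: "(\<Prod>s = 1..<length ?p.
        W (fst (?p ! s)) (fst (?p ! (s - 1))) w $$ (snd (?p ! s), snd (?p ! (s - 1)))) =
      (\<Prod>s = 1..<length p.
        W (fst (p ! s)) (fst (p ! (s - 1))) w $$ (snd (p ! s), snd (p ! (s - 1)))) *
      W l' (fst (last p)) w $$ (j, snd (last p))"
    using split[of "\<lambda>a b. W (fst a) (fst b) w $$ (snd a, snd b)"] by simp
  show ?thesis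
    unfolding path_value_def gates weights using assms by simp
qed

text \<open>Layers increase strictly, so the layer \<open>l'\<close> of the last unit bounds all
  earlier ones, and what precedes it is a path into layer \<open>l'\<close>. If
  \<open>l' = 0\<close>, nothing can precede it.\<close>

lemma snoc_in_paths_iff:
  "p @ [(l', j)] \<in> paths l n \<longleftrightarrow>
     l' < l \<and> j < n l' \<and> (if l' = 0 then p = [] else p \<in> paths l' n)"
proof (cases "p = []")
  case True
  then show ?thesis by (auto simp: paths_def)
next
  case False
  then obtain a r where p: "p = a # r"
    by (cases p) auto
  have "p @ [(l', j)] \<in> paths l n \<longleftrightarrow>
      l' < l \<and> j < n l' \<and> fst a = 0 \<and> sorted_wrt (<) (map fst p) \<and>
      (\<forall>b\<in>set p. fst b < l' \<and> snd b < n (fst b))"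
    unfolding paths_def p by (auto simp: sorted_wrt_append split_beta)
  moreover have "p \<in> paths l' n \<longleftrightarrow>
      fst a = 0 \<and> sorted_wrt (<) (map fst p) \<and> (\<forall>b\<in>set p. fst b < l' \<and> snd b < n (fst b))"
    unfolding paths_def p by (auto simp: split_beta)
  ultimately show ?thesis
    using p by auto
qed

text \<open>Removing the last unit inverts the map. Layer 0 gets the singleton \<open>{[]}\<close>
  because \<open>paths 0 n\<close> is empty, whereas a path may consist of its input unit
  alone.\<close>

lemma bij_betw_paths_snoc:
  "bij_betw (\<lambda>(l', j, p). p @ [(l', j)])
     (SIGMA l':{..<l}. {..<n l'} \<times> (if l' = 0 then {[]} else paths l' n)) (paths l n)"
proof (rule bij_betw_imageI)
  let ?S = "SIGMA l':{..<l}. {..<n l'} \<times> (if l' = 0 then {[]} else paths l' n)"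
  show "inj_on (\<lambda>(l', j, p). p @ [(l', j)]) ?S"
    by (auto simp: inj_on_def)
  show "(\<lambda>(l', j, p). p @ [(l', j)]) ` ?S = paths l n"
  proof (intro equalityI subsetI)
    fix p assume "p \<in> (\<lambda>(l', j, p). p @ [(l', j)]) ` ?S"
    then show "p \<in> paths l n"
      by (auto simp: snoc_in_paths_iff split: if_splits)
  next
    fix p assume p: "p \<in> paths l n"
    then have "p \<noteq> []"
      by (simp add: paths_def)
    then obtain q l' j where q: "p = q @ [(l', j)]"
      by (metis append_butlast_last_id surj_pair)
    with p have "(l', j, q) \<in> ?S"
      by (auto simp: snoc_in_paths_iff split: if_splits)
    with q show "p \<in> (\<lambda>(l', j, p). p @ [(l', j)]) ` ?S"
      by force
  qed
qed

text \<open>The nesting follows the recursion for the pre-activations: source layer, column of the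
  weight matrix, path into the source unit.\<close>

lemma sum_paths:
  "(\<Sum>p\<in>paths l n. f p) =
     (\<Sum>l'<l. \<Sum>j<n l'. \<Sum>p\<in>(if l' = 0 then {[]} else paths l' n). f (p @ [(l', j)]))"
proof -
  have "(\<Sum>p\<in>paths l n. f p) =
      (\<Sum>a\<in>(SIGMA l':{..<l}. {..<n l'} \<times> (if l' = 0 then {[]} else paths l' n)).
         f ((\<lambda>(l', j, p). p @ [(l', j)]) a))"
    by (rule sum.reindex_bij_betw[OF bij_betw_paths_snoc, symmetric])
  also have "\<dots> = (\<Sum>l'<l. \<Sum>(j, p)\<in>{..<n l'} \<times> (if l' = 0 then {[]} else paths l' n).
      f (p @ [(l', j)]))"
    by (subst sum.Sigma) (auto simp: finite_paths split_beta)
  also have "\<dots> = (\<Sum>l'<l. \<Sum>j<n l'. \<Sum>p\<in>(if l' = 0 then {[]} else paths l' n).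
      f (p @ [(l', j)]))"
    by (simp only: sum.cartesian_product)
  finally show ?thesis .
qed

text \<open>Strong induction on the layer, since every earlier layer may feed into layer
  \<open>l\<close>. A gate multiplies a pre-activation by a scalar, so the induction hypothesis
  distributes over the paths, and \<open>path_value_snoc\<close> absorbs the gate and the new
  edge.\<close>

lemma preact_eq_sum_paths:
  assumes net: "dag_network L n q W \<sigma> \<sigma>'"
    and x: "x \<in> carrier_vec (n 0)" and w: "w \<in> carrier_vec q"
    and "l \<le> L" "i < n l"
  shows "preact n W \<sigma> x w l $ i = (\<Sum>p\<in>paths l n. path_value W \<sigma>' x w l i p)"
  using assms(4,5)
proof (induction l arbitrary: i rule: less_induct)
  case (less l)
  let ?act = "\<lambda>l'. if l' = 0 then x else \<sigma> l' (preact n W \<sigma> x w l')"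
  have layer: "(W l l' w *\<^sub>v ?act l') $ i = (\<Sum>j<n l'. \<Sum>p\<in>(if l' = 0 then {[]} else paths l' n).
      path_value W \<sigma>' x w l i (p @ [(l', j)]))" if l': "l' < l" for l'
  proof -
    have W: "W l l' w \<in> carrier_mat (n l) (n l')"
      using net less.prems l' w unfolding dag_network_def by blast
    have dim: "dim_vec (preact n W \<sigma> x w l') = n l'"
      by (subst preact.simps) simp
    have gate: "\<sigma> l' (preact n W \<sigma> x w l') = \<sigma>' l' x w \<circ>\<^sub>v preact n W \<sigma> x w l'" if "l' \<noteq> 0"
    proof -
      have "l' \<in> {1..<L}"
        using less.prems l' that by simp
      then show ?thesis
        using net x w unfolding dag_network_def by blast
    qed
    have act: "?act l' \<in> carrier_vec (n l')"
    proof (cases "l' = 0")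
      case True
      then show ?thesis
        unfolding if_P[OF True] using x by simp
    next
      case False
      have "\<sigma>' l' x w \<circ>\<^sub>v preact n W \<sigma> x w l' \<in> carrier_vec (n l')"
        unfolding hadamard_def dim by (rule vec_carrier)
      then show ?thesis
        unfolding if_not_P[OF False] gate[OF False] .
    qed
    have entry: "W l l' w $$ (i, j) * ?act l' $ j =
        (\<Sum>p\<in>(if l' = 0 then {[]} else paths l' n). path_value W \<sigma>' x w l i (p @ [(l', j)]))"
      if j: "j < n l'" for j
    proof (cases "l' = 0")
      case True
      then show ?thesis by (simp add: path_value_singleton)
    next
      case False
      have "?act l' $ j = \<sigma>' l' x w $ j * preact n W \<sigma> x w l' $ j"
        using False gate dim j by (simp add: hadamard_def)
      also have "preact n W \<sigma> x w l' $ j = (\<Sum>p\<in>paths l' n. path_value W \<sigma>' x w l' j p)"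
        using less.IH[OF l' _ j] less.prems l' by simp
      finally have "W l l' w $$ (i, j) * ?act l' $ j = (\<Sum>p\<in>paths l' n.
          W l l' w $$ (i, j) * (\<sigma>' l' x w $ j * path_value W \<sigma>' x w l' j p))"
        by (simp add: sum_distrib_left)
      also have "\<dots> = (\<Sum>p\<in>paths l' n. path_value W \<sigma>' x w l i (p @ [(l', j)]))"
        by (intro sum.cong refl path_value_snoc[symmetric]) (auto simp: paths_def)
      finally show ?thesis
        using False by simp
    qed
    have "(W l l' w *\<^sub>v ?act l') $ i = row (W l l' w) i \<bullet> ?act l'"
      using W less.prems by (intro index_mult_mat_vec) simp
    also have "\<dots> = (\<Sum>j<n l'. row (W l l' w) i $ j * ?act l' $ j)"
      by (rule scalar_prod_eq_sum[OF act])
    also have "\<dots> = (\<Sum>j<n l'. W l l' w $$ (i, j) * ?act l' $ j)"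
      using W less.prems by (intro sum.cong refl arg_cong2[where f = "(*)"]) simp
    also have "\<dots> = (\<Sum>j<n l'. \<Sum>p\<in>(if l' = 0 then {[]} else paths l' n).
        path_value W \<sigma>' x w l i (p @ [(l', j)]))"
      by (intro sum.cong refl entry) simp
    finally show ?thesis .
  qed
  have "preact n W \<sigma> x w l $ i = (\<Sum>l'<l. (W l l' w *\<^sub>v ?act l') $ i)"
    using less.prems by (subst preact.simps) (rule index_vec)
  also have "\<dots> = (\<Sum>l'<l. \<Sum>j<n l'. \<Sum>p\<in>(if l' = 0 then {[]} else paths l' n).
      path_value W \<sigma>' x w l i (p @ [(l', j)]))"
    by (intro sum.cong refl layer) simp
  finally show ?case
    by (simp only: sum_paths[where l = l])
qed

text \<open>\<open>path_list\<close> enumerates the paths without repetition, so the scalar product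
  is the sum over the set of paths, whatever their order.\<close>

lemma preact_eq_scalar_prod_path_weights:
  assumes "dag_network L n q W \<sigma> \<sigma>'" "x \<in> carrier_vec (n 0)" "w \<in> carrier_vec q" "k < n L"
  shows "preact n W \<sigma> x w L $ k =
    (path_inputs L n x \<circ>\<^sub>v path_gates L n \<sigma>' x w) \<bullet> path_weights L n W w k"
proof -
  have "(path_inputs L n x \<circ>\<^sub>v path_gates L n \<sigma>' x w) \<bullet> path_weights L n W w k =
      (\<Sum>j<length (path_list L n). path_value W \<sigma>' x w L k (path_list L n ! j))"
    by (auto simp: scalar_prod_def hadamard_def path_inputs_def path_gates_def path_weights_def
        path_value_def Let_def lessThan_atLeast0 intro!: sum.cong)
  also have "\<dots> = (\<Sum>p\<in>paths L n. path_value W \<sigma>' x w L k p)"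
    by (rule sum.reindex_bij_betw, rule bij_betw_nth)
      (auto simp: distinct_path_list set_path_list)
  finally show ?thesis
    using preact_eq_sum_paths assms by simp
qed

section \<open>Norms, angles and quadratic forms in an orthonormal eigenbasis\<close>

lemma quadratic_form_eq_sum:
  fixes A :: "real mat"
  assumes "A \<in> carrier_mat N N" "w \<in> carrier_vec N"
  shows "w \<bullet> (A *\<^sub>v w) = (\<Sum>a<N. \<Sum>b<N. A $$ (a, b) * (w $ a * w $ b))"
  using assms
  by (auto simp: scalar_prod_def lessThan_atLeast0 sum_distrib_left mult.left_commute
      intro!: sum.cong)

lemma scalar_prod_self_nonneg: "0 \<le> v \<bullet> (v :: real vec)"
  by (simp add: scalar_prod_def sum_nonneg)

lemma l2_norm_nonneg: "0 \<le> l2_norm v"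
  by (simp add: l2_norm_def scalar_prod_self_nonneg)

lemma l2_norm_power2: "(l2_norm v)\<^sup>2 = v \<bullet> v"
  by (simp add: l2_norm_def scalar_prod_self_nonneg)

lemma l2_norm_eq_0_iff: "l2_norm v = 0 \<longleftrightarrow> v = 0\<^sub>v (dim_vec v)"
proof -
  have "l2_norm v = 0 \<longleftrightarrow> (\<forall>i<dim_vec v. v $ i = 0)"
    by (auto simp: l2_norm_def scalar_prod_def sum_nonneg_eq_0_iff)
  then show ?thesis
    by (auto intro!: eq_vecI) (metis index_zero_vec(1))
qed

lemma scalar_prod_abs_le_l2_norm:
  assumes "u \<in> carrier_vec N" "v \<in> carrier_vec N"
  shows "\<bar>u \<bullet> v\<bar> \<le> l2_norm u * l2_norm v"
proof -
  have "(u \<bullet> v)\<^sup>2 \<le> (u \<bullet> u) * (v \<bullet> v)"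
    using Cauchy_Schwarz_ineq_sum[of "\<lambda>a. u $ a" "\<lambda>a. v $ a" "{..<N}"] assms
    by (simp add: scalar_prod_eq_sum power2_eq_square)
  then have "sqrt ((u \<bullet> v)\<^sup>2) \<le> sqrt ((u \<bullet> u) * (v \<bullet> v))"
    by (rule real_sqrt_le_mono)
  then show ?thesis
    by (simp add: l2_norm_def real_sqrt_mult)
qed

lemma scalar_prod_eq_cos:
  assumes "u \<in> carrier_vec N" "v \<in> carrier_vec N" and "is_angle \<theta> u v"
  shows "u \<bullet> v = l2_norm u * l2_norm v * cos \<theta>"
proof (cases "l2_norm u = 0 \<or> l2_norm v = 0")
  \<comment> \<open>Here \<open>is_angle\<close> leaves \<theta> free, but both sides vanish:
    Cauchy-Schwarz bounds the scalar product by 0.\<close>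
  case True
  then show ?thesis
    using scalar_prod_abs_le_l2_norm[OF assms(1,2)] by auto
next
  case False
  then have pos: "0 < l2_norm u * l2_norm v"
    using l2_norm_nonneg[of u] l2_norm_nonneg[of v] by simp
  \<comment> \<open>Cauchy-Schwarz places the quotient in the interval on which \<open>cos\<close>
    undoes \<open>arccos\<close>.\<close>
  have "\<bar>(u \<bullet> v) / (l2_norm u * l2_norm v)\<bar> \<le> 1"
    using scalar_prod_abs_le_l2_norm[OF assms(1,2)] pos
    by (simp add: l2_norm_nonneg abs_of_nonneg)
  then have "cos \<theta> = (u \<bullet> v) / (l2_norm u * l2_norm v)"
    using assms(3) False unfolding is_angle_def l2_norm_eq_0_iff
    by (simp add: cos_arccos_abs)
  then show ?thesis
    using False by simp
qed

text \<open>The matrix \<open>U\<close> with columns \<open>u j\<close> is orthogonal, so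
  \<open>w\<close> is the sum of the vectors \<open>u j\<close> with coefficients
  \<open>u j \<bullet> w\<close>, and \<open>A\<close> acts on each of them as the scalar
  \<open>\<mu> j\<close>.\<close>

lemma quadratic_form_eigensystem:
  assumes A: "A \<in> carrier_mat N N" and sys: "orthonormal_eigensystem A \<mu> u"
    and w: "w \<in> carrier_vec N"
  shows "w \<bullet> (A *\<^sub>v w) = (\<Sum>j<N. \<mu> j * (u j \<bullet> w)\<^sup>2)"
proof -
  define U where "U = mat N N (\<lambda>(i, j). u j $ i)"
  have u: "u j \<in> carrier_vec N" "A *\<^sub>v u j = \<mu> j \<cdot>\<^sub>v u j" if "j < N" for j
    using sys A that by (auto simp: orthonormal_eigensystem_def eigenvector_def)
  have U: "U \<in> carrier_mat N N" "transpose_mat U \<in> carrier_mat N N"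
    by (auto simp: U_def)
  have "transpose_mat U * U = 1\<^sub>m N"
  proof (rule eq_matI)
    fix i j assume "i < dim_row (1\<^sub>m N :: real mat)" "j < dim_col (1\<^sub>m N :: real mat)"
    moreover have "u i \<bullet> u j = (if i = j then 1 else 0)" if "i < N" "j < N"
      using sys A that by (auto simp: orthonormal_eigensystem_def)
    ultimately show "(transpose_mat U * U) $$ (i, j) = 1\<^sub>m N $$ (i, j)"
      using u(1)[of j] by (simp add: U_def scalar_prod_def)
  qed (auto simp: U_def)
  \<comment> \<open>For square matrices a left inverse is a right inverse; this turns orthonormality
    of the columns into completeness.\<close>
  then have "U * transpose_mat U = 1\<^sub>m N"
    using U mat_mult_left_right_inverse by blast
  then have expand: "w = U *\<^sub>v (transpose_mat U *\<^sub>v w)"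
    using assoc_mult_mat_vec[OF U w] w by simp
  have coeff: "(transpose_mat U *\<^sub>v w) $ j = u j \<bullet> w" if "j < N" for j
    using that w by (simp add: U_def scalar_prod_def)
  have w_entry: "w $ a = (\<Sum>j<N. (u j \<bullet> w) * u j $ a)" if "a < N" for a
  proof -
    have "w $ a = (U *\<^sub>v (transpose_mat U *\<^sub>v w)) $ a"
      using expand by simp
    also have "\<dots> = (\<Sum>j<N. U $$ (a, j) * (transpose_mat U *\<^sub>v w) $ j)"
      using that U by (auto simp: scalar_prod_def lessThan_atLeast0)
    finally show ?thesis
      using that coeff by (simp add: U_def ac_simps)
  qed
  have Au: "(\<Sum>b<N. A $$ (a, b) * u j $ b) = \<mu> j * u j $ a" if "a < N" "j < N" for a j
  proof -
    have "(A *\<^sub>v u j) $ a = (\<mu> j \<cdot>\<^sub>v u j) $ a"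
      using u that by simp
    then show ?thesis
      using that u(1)[OF that(2)] A by (auto simp: scalar_prod_def lessThan_atLeast0)
  qed
  have "w \<bullet> (A *\<^sub>v w) = (\<Sum>a<N. w $ a * (\<Sum>b<N. A $$ (a, b) * w $ b))"
    using A w by (simp add: quadratic_form_eq_sum sum_distrib_left ac_simps)
  \<comment> \<open>Only the inner copy of \<open>w\<close> is expanded; the outer one is kept to
    form the second factor \<open>u j \<bullet> w\<close>.\<close>
  also have "\<dots> = (\<Sum>a<N. w $ a * (\<Sum>b<N. \<Sum>j<N. (u j \<bullet> w) * (A $$ (a, b) * u j $ b)))"
    by (intro sum.cong refl arg_cong2[where f = "(*)"])
      (simp add: w_entry sum_distrib_left ac_simps)
  also have "\<dots> = (\<Sum>a<N. w $ a * (\<Sum>j<N. (u j \<bullet> w) * (\<Sum>b<N. A $$ (a, b) * u j $ b)))"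
    by (subst sum.swap) (simp add: sum_distrib_left)
  also have "\<dots> = (\<Sum>a<N. \<Sum>j<N. \<mu> j * (u j \<bullet> w) * (u j $ a * w $ a))"
    by (simp only: sum_distrib_left[of "w $ _"], intro sum.cong refl) (simp add: Au)
  also have "\<dots> = (\<Sum>j<N. \<mu> j * (u j \<bullet> w) * (\<Sum>a<N. u j $ a * w $ a))"
    by (subst sum.swap) (simp add: sum_distrib_left)
  also have "\<dots> = (\<Sum>j<N. \<mu> j * (u j \<bullet> w)\<^sup>2)"
    using w by (simp add: scalar_prod_eq_sum power2_eq_square ac_simps)
  finally show ?thesis .
qed

section \<open>Measurability of coordinates and expansion of the squared loss\<close>

lemma borel_measurable_vec_index:
  assumes "i < d"
  shows "(\<lambda>v. v $ i) \<in> borel_measurable (borel_vec d)"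
proof -
  have "(\<lambda>v. \<lambda>i\<in>{..<d}. v $ i) \<in> borel_vec d \<rightarrow>\<^sub>M Pi\<^sub>M {..<d} (\<lambda>_. borel)"
    unfolding borel_vec_def by (rule measurable_vimage_algebra1) (auto simp: space_PiM)
  from measurable_compose[OF this measurable_component_singleton[of i]] assms
  show ?thesis by simp
qed

text \<open>Expanded down to the monomials \<open>u $ a * u $ b\<close> and
  \<open>y * u $ a\<close>, because integrability is assumed for exactly these products; the entries
  of \<open>w\<close> are constant coefficients.\<close>

lemma square_loss_expand:
  fixes u w :: "real vec"
  assumes "u \<in> carrier_vec N" "w \<in> carrier_vec N"
  shows "(u \<bullet> w - y)\<^sup>2 =
    (\<Sum>a<N. \<Sum>b<N. w $ a * w $ b * (u $ a * u $ b)) - 2 * (\<Sum>a<N. w $ a * (y * u $ a)) + y\<^sup>2"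
proof -
  have "(u \<bullet> w)\<^sup>2 = (\<Sum>a<N. \<Sum>b<N. w $ a * w $ b * (u $ a * u $ b))"
    unfolding scalar_prod_eq_sum[OF assms(2)] power2_eq_square sum_product
    by (simp add: ac_simps)
  moreover have "(u \<bullet> w) * y = (\<Sum>a<N. w $ a * (y * u $ a))"
    using assms by (simp add: scalar_prod_eq_sum sum_distrib_left ac_simps)
  ultimately show ?thesis
    by (simp add: power2_diff algebra_simps)
qed

section \<open>The Rayleigh quotient of a symmetric matrix\<close>

text \<open>A maximiser of the form on the unit sphere exists by compactness and is an eigenvector
  whose eigenvalue is the maximum; homogeneity extends the bound to all vectors. Vectors appear as
  functions on \<open>nat\<close>, with the product topology.\<close>

lemma quadratic_form_le_lambda_max:
  fixes A :: "real mat"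
  assumes A: "A \<in> carrier_mat N N" and sym: "\<And>a b. a < N \<Longrightarrow> b < N \<Longrightarrow> A $$ (a, b) = A $$ (b, a)"
    and w: "w \<in> carrier_vec N"
  shows "w \<bullet> (A *\<^sub>v w) \<le> lambda_max A * (l2_norm w)\<^sup>2"
proof (cases "N = 0")
  \<comment> \<open>The spectrum is empty here, so \<open>lambda_max A\<close> is an unspecified
    number, but it is multiplied by a zero norm.\<close>
  case True
  then show ?thesis
    using w A by (simp add: l2_norm_power2 scalar_prod_def)
next
  case False
  define Q where "Q f = (\<Sum>a<N. \<Sum>b<N. A $$ (a, b) * (f a * f b))" for f :: "nat \<Rightarrow> real"
  define S where "S f = (\<Sum>a<N. (f a)\<^sup>2)" for f :: "nat \<Rightarrow> real"
  \<comment> \<open>The unit sphere, with the irrelevant coordinates set to zero; it is compact by Tychonoff.\<close>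
  define K where "K = (Pi\<^sub>E UNIV (\<lambda>a. if a < N then {-1..1 :: real} else {0})) \<inter> {f. S f = 1}"
  have cont_Q: "continuous_on X Q" and cont_S: "continuous_on X S" for X
    unfolding Q_def S_def
    by (intro continuous_intros continuous_on_subset[OF continuous_on_product_coordinates]; simp)+
  have "compactin (product_topology (\<lambda>_. euclidean) UNIV)
      (Pi\<^sub>E UNIV (\<lambda>a. if a < N then {-1..1 :: real} else {0}))"
    by (subst compactin_PiE) auto
  then have "compact (Pi\<^sub>E UNIV (\<lambda>a. if a < N then {-1..1 :: real} else {0}))"
    by (simp add: euclidean_product_topology)
  moreover have "closed {f. S f = 1}"
    using cont_S by (intro closed_Collect_eq) auto
  ultimately have "compact K"
    unfolding K_def by (rule compact_Int_closed)
  \<comment> \<open>The first unit vector shows that the sphere is nonempty; this is where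
    \<open>N\<close> must be positive.\<close>
  moreover have "(\<lambda>a. if a = 0 then 1 else 0) \<in> K"
    using False by (auto simp: K_def S_def if_distrib[of "\<lambda>r. r\<^sup>2"] cong: if_cong)
  ultimately obtain f where "f \<in> K" and max: "\<And>g. g \<in> K \<Longrightarrow> Q g \<le> Q f"
    using continuous_attains_sup[OF _ _ cont_Q] by (metis empty_iff)
  then have S1: "S f = 1"
    by (simp add: K_def)
  \<comment> \<open>Both sides are homogeneous of degree two, so it suffices to normalise
    \<open>g\<close>, unless its first \<open>N\<close> coordinates vanish.\<close>
  have bound: "Q g \<le> Q f * S g" for g
  proof (cases "S g = 0")
    case True
    then have "g a = 0" if "a < N" for a
      using that by (simp add: S_def sum_nonneg_eq_0_iff)
    then show ?thesis
      by (simp add: True Q_def)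
  next
    case False
    then have pos: "0 < S g"
      by (simp add: S_def sum_nonneg order.not_eq_order_implies_strict[OF not_sym])
    \<comment> \<open>The normalisation of \<open>g\<close>, cut off beyond \<open>N\<close> because
      members of \<open>K\<close> vanish there.\<close>
    define h where "h a = (if a < N then g a / sqrt (S g) else 0)" for a
    have "S h = (\<Sum>a<N. (g a)\<^sup>2 / S g)"
      using pos by (auto simp: S_def[of h] h_def power_divide intro!: sum.cong)
    also have "\<dots> = 1"
      using pos by (simp add: S_def flip: sum_divide_distrib)
    finally have Sh: "S h = 1" .
    have "\<bar>h a\<bar> \<le> 1" if "a < N" for a
      using member_le_sum[of a "{..<N}" "\<lambda>a. (h a)\<^sup>2"] that Sh
      by (simp add: S_def flip: abs_square_le_1)
    moreover have "h a = 0" if "\<not> a < N" for a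
      using that by (simp add: h_def)
    ultimately have "h \<in> K"
      using Sh by (auto simp: K_def PiE_iff abs_le_iff)
    have "Q h = (\<Sum>a<N. \<Sum>b<N. A $$ (a, b) * (g a * g b) / S g)"
      using pos by (auto simp: Q_def[of h] h_def intro!: sum.cong)
    also have "\<dots> = Q g / S g"
      by (simp add: Q_def flip: sum_divide_distrib)
    finally show ?thesis
      using max[OF \<open>h \<in> K\<close>] pos by (simp add: divide_le_eq)
  qed
  \<comment> \<open>The first variation of \<open>Q - Q f * S\<close> at its maximiser \<open>f\<close> vanishes in each coordinate
    direction, which is the eigenvector equation.\<close>
  have stationary: "(\<Sum>b<N. A $$ (a, b) * f b) = Q f * f a" if a: "a < N" for a
  proof -
    define e :: "nat \<Rightarrow> real" where "e b = (if b = a then 1 else 0)" for b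
    \<comment> \<open>Along \<open>f + t * e\<close> the function \<open>Q - Q f * S\<close> equals
      \<open>2 * t * c + t\<^sup>2 * d\<close>, and \<open>bound\<close> says that it is never
      positive.\<close>
    define c where "c = (\<Sum>b<N. A $$ (a, b) * f b) - Q f * f a"
    define d where "d = A $$ (a, a) - Q f"
    have e_sum: "(\<Sum>b<N. r b * e b) = r a" for r :: "nat \<Rightarrow> real"
      using a by (simp add: e_def if_distrib cong: if_cong)
    have Sf: "S (\<lambda>b. f b + t * e b) = 1 + 2 * t * f a + t\<^sup>2" for t
    proof -
      have "S (\<lambda>b. f b + t * e b) = S f + 2 * t * (\<Sum>b<N. f b * e b) + t\<^sup>2 * (\<Sum>b<N. e b * e b)"
        by (simp add: S_def power2_sum power_mult_distrib sum.distrib sum_distrib_left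
            power2_eq_square algebra_simps)
      then show ?thesis
        by (simp add: e_sum S1) (simp add: e_def)
    qed
    have Qf: "Q (\<lambda>b. f b + t * e b) =
        Q f + 2 * t * (\<Sum>b<N. A $$ (a, b) * f b) + t\<^sup>2 * A $$ (a, a)" for t
    proof -
      have "Q (\<lambda>b. f b + t * e b) = Q f +
          t * (\<Sum>i<N. (\<Sum>b<N. A $$ (i, b) * f b) * e i) +
          t * (\<Sum>i<N. f i * (\<Sum>b<N. A $$ (i, b) * e b)) +
          t\<^sup>2 * (\<Sum>i<N. (\<Sum>b<N. A $$ (i, b) * e b) * e i)"
        by (simp add: Q_def sum.distrib sum_distrib_left sum_distrib_right
            power2_eq_square algebra_simps)
      \<comment> \<open>Symmetry of \<open>A\<close> makes the two cross terms equal.\<close>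
      also have "(\<Sum>i<N. f i * (\<Sum>b<N. A $$ (i, b) * e b)) = (\<Sum>b<N. A $$ (a, b) * f b)"
        using sym a by (auto simp: e_sum intro!: sum.cong)
      finally show ?thesis
        by (simp add: e_sum)
    qed
    have ineq: "2 * t * c + t\<^sup>2 * d \<le> 0" for t
      using bound[of "\<lambda>b. f b + t * e b"] by (simp add: Sf Qf c_def d_def algebra_simps)
    have "c = 0"
    proof (rule ccontr)
      assume "c \<noteq> 0"
      \<comment> \<open>This \<open>t\<close> has the sign of \<open>c\<close> and is small enough
        for the linear term to dominate the quadratic one; the summand 1 keeps the denominator
        positive when \<open>d = 0\<close>.\<close>
      define t where "t = c / (\<bar>d\<bar> + 1)"
      have c: "c = t * (\<bar>d\<bar> + 1)"
        by (simp add: t_def)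
      have "2 * t * c + t\<^sup>2 * d = t\<^sup>2 * (2 * (\<bar>d\<bar> + 1) + d)"
        using c by (simp add: power2_eq_square algebra_simps)
      moreover have "0 < t\<^sup>2 * (2 * (\<bar>d\<bar> + 1) + d)"
        using \<open>c \<noteq> 0\<close> by (intro mult_pos_pos) (auto simp: t_def)
      ultimately show False
        using ineq[of t] by simp
    qed
    then show ?thesis
      by (simp add: c_def)
  qed
  have "eigenvector A (vec N f) (Q f)"
  proof -
    have "vec N f \<noteq> 0\<^sub>v N"
    proof
      assume zero: "vec N f = 0\<^sub>v N"
      have "f a = 0" if "a < N" for a
        using that arg_cong[OF zero, of "\<lambda>v. v $ a"] by simp
      then show False
        using S1 by (simp add: S_def)
    qed
    moreover have "A *\<^sub>v vec N f = Q f \<cdot>\<^sub>v vec N f"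
      using A stationary by (auto simp: scalar_prod_def lessThan_atLeast0 intro!: eq_vecI)
    ultimately show ?thesis
      using A by (auto simp: eigenvector_def)
  qed
  then have "Q f \<in> spectrum A"
    by (auto simp: spectrum_def eigenvalue_def)
  then have "Q f \<le> lambda_max A"
    unfolding lambda_max_def using card_finite_spectrum(1)[OF A] by (rule Max_ge[rotated])
  have "w \<bullet> (A *\<^sub>v w) = Q (\<lambda>a. w $ a)"
    using A w by (simp add: quadratic_form_eq_sum Q_def)
  also have "\<dots> \<le> Q f * S (\<lambda>a. w $ a)"
    by (rule bound)
  also have "\<dots> \<le> lambda_max A * S (\<lambda>a. w $ a)"
    using \<open>Q f \<le> lambda_max A\<close> by (intro mult_right_mono) (simp_all add: S_def sum_nonneg)
  also have "S (\<lambda>a. w $ a) = (l2_norm w)\<^sup>2"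
    unfolding l2_norm_power2 using w by (simp add: S_def scalar_prod_eq_sum power2_eq_square)
  finally show ?thesis .
qed

section \<open>The gap between expected and empirical risk\<close>

theorem theorem7:
  fixes L q dy m :: nat
    and n :: "nat \<Rightarrow> nat"
    and W :: "nat \<Rightarrow> nat \<Rightarrow> real vec \<Rightarrow> real mat"
    and \<sigma> :: "nat \<Rightarrow> real vec \<Rightarrow> real vec"
    and \<sigma>' :: "nat \<Rightarrow> real vec \<Rightarrow> real vec \<Rightarrow> real vec"
    and P :: "(real vec \<times> real vec) measure"
    and xs ys :: "nat \<Rightarrow> real vec"
    and wS :: "real vec"
    and z :: "real vec \<Rightarrow> real vec"
    and wbar v :: "nat \<Rightarrow> real vec"
    and N :: nat
    and G :: "real mat"
    and c_y :: real
    and net :: "real vec \<Rightarrow> real vec"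
  defines "N \<equiv> length (path_list L n)"
    and "z \<equiv> (\<lambda>x. path_inputs L n x \<circ>\<^sub>v path_gates L n \<sigma>' x wS)"
    and "wbar \<equiv> path_weights L n W wS"
    and "net \<equiv> (\<lambda>x. preact n W \<sigma> x wS L)"
    and "G \<equiv> mat N N (\<lambda>(a, b).
           (LINT (x, y)|P. z x $ a * z x $ b) -
           (1 / real m) * (\<Sum>i<m. z (xs i) $ a * z (xs i) $ b))"
    and "v \<equiv> (\<lambda>k. vec N (\<lambda>a.
           (1 / real m) * (\<Sum>i<m. ys i $ k * z (xs i) $ a) -
           (LINT (x, y)|P. y $ k * z x $ a)))"
    and "c_y \<equiv> (LINT (x, y)|P. (l2_norm y)\<^sup>2) - (1 / real m) * (\<Sum>i<m. (l2_norm (ys i))\<^sup>2)"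
  assumes network: "dag_network L n q W \<sigma> \<sigma>'" "n L = dy"
    and parameters: "wS \<in> carrier_vec q"
    and data: "0 < m" "\<And>i. i < m \<Longrightarrow> xs i \<in> carrier_vec (n 0)" "\<And>i. i < m \<Longrightarrow> ys i \<in> carrier_vec dy"
    and distribution: "prob_space P" "sets P = sets (borel_vec (n 0) \<Otimes>\<^sub>M borel_vec dy)"
    and finite_expectations:
      "\<And>a b. a < N \<Longrightarrow> b < N \<Longrightarrow> integrable P (\<lambda>(x, y). z x $ a * z x $ b)"
      "\<And>k a. k < dy \<Longrightarrow> a < N \<Longrightarrow> integrable P (\<lambda>(x, y). y $ k * z x $ a)"
      "integrable P (\<lambda>(x, y). (l2_norm y)\<^sup>2)"
  shows "(\<forall>\<mu> u \<theta>1 \<theta>2.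
            orthonormal_eigensystem G \<mu> u \<and>
            (\<forall>k<dy. \<forall>j<N. is_angle (\<theta>1 k j) (u j) (wbar k)) \<and>
            (\<forall>k<dy. is_angle (\<theta>2 k) (v k) (wbar k)) \<longrightarrow>
            risk P dy net - empirical_risk m xs ys dy net - c_y =
              (\<Sum>k<dy. 2 * l2_norm (v k) * l2_norm (wbar k) * cos (\<theta>2 k) +
                 (l2_norm (wbar k))\<^sup>2 * (\<Sum>j<N. \<mu> j * (cos (\<theta>1 k j))\<^sup>2))) \<and>
         risk P dy net - empirical_risk m xs ys dy net - c_y
           \<le> (\<Sum>k<dy. 2 * l2_norm (v k) * l2_norm (wbar k) +
                lambda_max G * (l2_norm (wbar k))\<^sup>2)"
proof -
  have z: "z x \<in> carrier_vec N" for x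
    unfolding z_def N_def hadamard_def path_gates_def dim_vec by (rule vec_carrier)
  have wbar: "wbar k \<in> carrier_vec N" for k
    unfolding wbar_def N_def path_weights_def by (rule vec_carrier)
  have G: "G \<in> carrier_mat N N"
    unfolding G_def by (rule mat_carrier)
  have v: "v k \<in> carrier_vec N" for k
    unfolding v_def by (rule vec_carrier)
  \<comment> \<open>Every point of the space has the right dimensions, so the path expansion applies
    everywhere under the integral.\<close>
  have space: "space P = carrier_vec (n 0) \<times> carrier_vec dy"
    using sets_eq_imp_space_eq[OF distribution(2)]
    by (simp add: space_pair_measure borel_vec_def)
  have net: "net x $ k = z x \<bullet> wbar k" if "x \<in> carrier_vec (n 0)" "k < dy" for x k
    unfolding net_def z_def wbar_def
    by (rule preact_eq_scalar_prod_path_weights[OF network(1)]) (use that parameters network(2) in auto)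
  \<comment> \<open>With the target as a real parameter \<open>t\<close>, one polynomial serves both
    the random and the sampled outputs.\<close>
  define loss where "loss k x t =
    (\<Sum>a<N. \<Sum>b<N. wbar k $ a * wbar k $ b * (z x $ a * z x $ b)) -
    2 * (\<Sum>a<N. wbar k $ a * (t * z x $ a)) + t\<^sup>2" for k x and t :: real
  have loss: "(net x $ k - t)\<^sup>2 = loss k x t" if "x \<in> carrier_vec (n 0)" "k < dy" for x k t
    unfolding loss_def net[OF that] by (rule square_loss_expand[OF z wbar])
  have norm_y: "(l2_norm y)\<^sup>2 = (\<Sum>k<dy. (y $ k)\<^sup>2)" if "y \<in> carrier_vec dy" for y
    unfolding l2_norm_power2 scalar_prod_eq_sum[OF that] by (simp add: power2_eq_square)
  \<comment> \<open>Only the squared norm of \<open>y\<close> is assumed integrable; it dominates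
    each squared coordinate, which is measurable for the given \<sigma>-algebra.\<close>
  have int_y: "integrable P (\<lambda>p. (snd p $ k)\<^sup>2)" if k: "k < dy" for k
  proof (rule Bochner_Integration.integrable_bound)
    show "integrable P (\<lambda>p. (l2_norm (snd p))\<^sup>2)"
      using finite_expectations(3) by (simp add: case_prod_unfold)
    have "(\<lambda>p. snd p $ k) \<in> borel_measurable (borel_vec (n 0) \<Otimes>\<^sub>M borel_vec dy)"
      by (rule measurable_compose[OF measurable_snd borel_measurable_vec_index[OF k]])
    then have [measurable]: "(\<lambda>p. snd p $ k) \<in> borel_measurable P"
      using measurable_cong_sets[OF distribution(2) refl] by blast
    show "(\<lambda>p. (snd p $ k)\<^sup>2) \<in> borel_measurable P"
      by measurable
    show "AE p in P. norm ((snd p $ k)\<^sup>2) \<le> norm ((l2_norm (snd p))\<^sup>2)"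
    proof (rule AE_I2)
      fix p assume "p \<in> space P"
      then have "snd p \<in> carrier_vec dy"
        by (auto simp: space)
      then show "norm ((snd p $ k)\<^sup>2) \<le> norm ((l2_norm (snd p))\<^sup>2)"
        using norm_y[of "snd p"] member_le_sum[of k "{..<dy}" "\<lambda>k. (snd p $ k)\<^sup>2"] k by simp
    qed
  qed
  have int_zz: "integrable P (\<lambda>p. z (fst p) $ a * z (fst p) $ b)" if "a < N" "b < N" for a b
    using finite_expectations(1)[OF that] by (simp add: case_prod_unfold)
  have int_yz: "integrable P (\<lambda>p. snd p $ k * z (fst p) $ a)" if "k < dy" "a < N" for k a
    using finite_expectations(2)[OF that] by (simp add: case_prod_unfold)
  \<comment> \<open>The expected risk depends on \<open>P\<close> only through these moments, and
    the empirical risk is the same expression in the sample moments \<open>Szz\<close>,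
    \<open>Syz\<close> and \<open>Syy\<close>.\<close>
  define Ezz where "Ezz a b = (LINT p|P. z (fst p) $ a * z (fst p) $ b)" for a b
  define Eyz where "Eyz k a = (LINT p|P. snd p $ k * z (fst p) $ a)" for k a
  define Eyy where "Eyy k = (LINT p|P. (snd p $ k)\<^sup>2)" for k
  define Szz where "Szz a b = (\<Sum>i<m. z (xs i) $ a * z (xs i) $ b) / real m" for a b
  define Syz where "Syz k a = (\<Sum>i<m. ys i $ k * z (xs i) $ a) / real m" for k a
  define Syy where "Syy k = (\<Sum>i<m. (ys i $ k)\<^sup>2) / real m" for k

  \<comment> \<open>This form yields integrability and the value of the integral at once;
    integrability is needed to interchange the integral with the sum over the outputs.\<close>
  have "has_bochner_integral P (\<lambda>p. loss k (fst p) (snd p $ k))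
      ((\<Sum>a<N. \<Sum>b<N. wbar k $ a * wbar k $ b * Ezz a b) -
        2 * (\<Sum>a<N. wbar k $ a * Eyz k a) + Eyy k)"
    if k: "k < dy" for k
    unfolding loss_def Ezz_def Eyz_def Eyy_def
    by (intro has_bochner_integral_add has_bochner_integral_diff has_bochner_integral_sum
        has_bochner_integral_mult_right has_bochner_integral_integrable int_zz int_yz int_y k)
      (simp_all add: k)
  then have risk_k: "integrable P (\<lambda>p. loss k (fst p) (snd p $ k))"
      "(LINT p|P. loss k (fst p) (snd p $ k)) =
        (\<Sum>a<N. \<Sum>b<N. wbar k $ a * wbar k $ b * Ezz a b) -
        2 * (\<Sum>a<N. wbar k $ a * Eyz k a) + Eyy k"
    if "k < dy" for k
    using that by (auto simp: has_bochner_integral_iff)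
  have "risk P dy net = (LINT p|P. (\<Sum>k<dy. loss k (fst p) (snd p $ k)))"
    unfolding risk_def by (rule Bochner_Integration.integral_cong) (auto simp: space loss)
  also have "\<dots> = (\<Sum>k<dy. (\<Sum>a<N. \<Sum>b<N. wbar k $ a * wbar k $ b * Ezz a b) -
      2 * (\<Sum>a<N. wbar k $ a * Eyz k a) + Eyy k)"
    by (simp add: risk_k)
  finally have risk: "risk P dy net = \<dots>" .

  have emp_k: "(\<Sum>i<m. loss k (xs i) (ys i $ k)) / real m =
      (\<Sum>a<N. \<Sum>b<N. wbar k $ a * wbar k $ b * Szz a b) - 2 * (\<Sum>a<N. wbar k $ a * Syz k a) + Syy k" for k
  proof -
    have "(\<Sum>i<m. \<Sum>a<N. \<Sum>b<N. wbar k $ a * wbar k $ b * (z (xs i) $ a * z (xs i) $ b)) =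
        (\<Sum>a<N. \<Sum>b<N. wbar k $ a * wbar k $ b * (\<Sum>i<m. z (xs i) $ a * z (xs i) $ b))"
      unfolding sum_distrib_left by (subst sum.swap, subst (2) sum.swap) (rule refl)
    moreover have "(\<Sum>i<m. \<Sum>a<N. wbar k $ a * (ys i $ k * z (xs i) $ a)) =
        (\<Sum>a<N. wbar k $ a * (\<Sum>i<m. ys i $ k * z (xs i) $ a))"
      unfolding sum_distrib_left by (rule sum.swap)
    ultimately have "(\<Sum>i<m. loss k (xs i) (ys i $ k)) =
        (\<Sum>a<N. \<Sum>b<N. wbar k $ a * wbar k $ b * (\<Sum>i<m. z (xs i) $ a * z (xs i) $ b)) -
        2 * (\<Sum>a<N. wbar k $ a * (\<Sum>i<m. ys i $ k * z (xs i) $ a)) + (\<Sum>i<m. (ys i $ k)\<^sup>2)"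
      by (simp only: loss_def sum.distrib sum_subtractf flip: sum_distrib_left[of 2])
    then show ?thesis
      by (simp add: Szz_def Syz_def Syy_def add_divide_distrib diff_divide_distrib
          flip: sum_divide_distrib)
  qed
  have "empirical_risk m xs ys dy net = (\<Sum>i<m. \<Sum>k<dy. loss k (xs i) (ys i $ k)) / real m"
    unfolding empirical_risk_def using data by (simp add: loss)
  also have "\<dots> = (\<Sum>k<dy. (\<Sum>i<m. loss k (xs i) (ys i $ k)) / real m)"
    by (subst sum.swap) (simp add: sum_divide_distrib)
  finally have emp: "empirical_risk m xs ys dy net = \<dots>" .

  have "(LINT (x, y)|P. (l2_norm y)\<^sup>2) = (LINT p|P. (\<Sum>k<dy. (snd p $ k)\<^sup>2))"
    by (rule Bochner_Integration.integral_cong) (auto simp: space norm_y)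
  also have "\<dots> = (\<Sum>k<dy. Eyy k)"
    by (simp add: int_y Eyy_def)
  finally have "(LINT (x, y)|P. (l2_norm y)\<^sup>2) = (\<Sum>k<dy. Eyy k)" .
  moreover have "(1 / real m) * (\<Sum>i<m. (l2_norm (ys i))\<^sup>2) = (\<Sum>k<dy. Syy k)"
  proof -
    have "(\<Sum>i<m. (l2_norm (ys i))\<^sup>2) = (\<Sum>i<m. \<Sum>k<dy. (ys i $ k)\<^sup>2)"
      using data by (intro sum.cong refl norm_y) simp
    also have "\<dots> = (\<Sum>k<dy. \<Sum>i<m. (ys i $ k)\<^sup>2)"
      by (rule sum.swap)
    finally show ?thesis
      by (simp add: Syy_def sum_divide_distrib)
  qed
  ultimately have c_y: "c_y = (\<Sum>k<dy. Eyy k) - (\<Sum>k<dy. Syy k)"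
    unfolding c_y_def by simp

  have "wbar k \<bullet> (G *\<^sub>v wbar k) = (\<Sum>a<N. \<Sum>b<N. wbar k $ a * wbar k $ b * (Ezz a b - Szz a b))" for k
    unfolding quadratic_form_eq_sum[OF G wbar]
    by (intro sum.cong refl) (simp add: G_def Ezz_def Szz_def case_prod_unfold)
  then have quad: "wbar k \<bullet> (G *\<^sub>v wbar k) =
      (\<Sum>a<N. \<Sum>b<N. wbar k $ a * wbar k $ b * Ezz a b) -
      (\<Sum>a<N. \<Sum>b<N. wbar k $ a * wbar k $ b * Szz a b)" for k
    by (simp add: right_diff_distrib sum_subtractf)
  \<comment> \<open>\<open>v\<close> is sample minus expectation, opposite to \<open>G\<close>,
    which matches the factor -2 of the linear term of the loss.\<close>
  have "v k \<bullet> wbar k = (\<Sum>a<N. wbar k $ a * (Syz k a - Eyz k a))" for k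
    unfolding scalar_prod_eq_sum[OF wbar]
    by (intro sum.cong refl) (simp add: v_def Eyz_def Syz_def case_prod_unfold)
  then have lin: "v k \<bullet> wbar k = (\<Sum>a<N. wbar k $ a * Syz k a) - (\<Sum>a<N. wbar k $ a * Eyz k a)" for k
    by (simp add: right_diff_distrib sum_subtractf)
  \<comment> \<open>The terms quadratic in \<open>y\<close> are free of the weights and cancel
    against \<open>c_y\<close>.\<close>
  have gap: "risk P dy net - empirical_risk m xs ys dy net - c_y =
      (\<Sum>k<dy. 2 * (v k \<bullet> wbar k) + wbar k \<bullet> (G *\<^sub>v wbar k))"
    unfolding risk emp emp_k c_y quad lin
    by (simp add: sum.distrib sum_subtractf algebra_simps)

  show ?thesis
  proof (intro conjI allI impI)
    fix \<mu> u \<theta>1 \<theta>2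
    assume *: "orthonormal_eigensystem G \<mu> u \<and>
      (\<forall>k<dy. \<forall>j<N. is_angle (\<theta>1 k j) (u j) (wbar k)) \<and>
      (\<forall>k<dy. is_angle (\<theta>2 k) (v k) (wbar k))"
    then have sys: "orthonormal_eigensystem G \<mu> u"
      by blast
    have u: "u j \<in> carrier_vec N" "l2_norm (u j) = 1" if "j < N" for j
      using sys that G by (auto simp: orthonormal_eigensystem_def eigenvector_def l2_norm_def)
    have "v k \<bullet> wbar k = l2_norm (v k) * l2_norm (wbar k) * cos (\<theta>2 k)" if "k < dy" for k
      using * that by (intro scalar_prod_eq_cos[OF v wbar]) blast
    moreover have "wbar k \<bullet> (G *\<^sub>v wbar k) =
        (l2_norm (wbar k))\<^sup>2 * (\<Sum>j<N. \<mu> j * (cos (\<theta>1 k j))\<^sup>2)" if k: "k < dy" for k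
    proof -
      have "u j \<bullet> wbar k = l2_norm (wbar k) * cos (\<theta>1 k j)" if j: "j < N" for j
      proof -
        have "is_angle (\<theta>1 k j) (u j) (wbar k)"
          using * k j by blast
        from scalar_prod_eq_cos[OF u(1)[OF j] wbar this] u(2)[OF j] show ?thesis
          by simp
      qed
      then show ?thesis
        unfolding quadratic_form_eigensystem[OF G sys wbar]
        by (simp add: sum_distrib_left power_mult_distrib mult.left_commute)
    qed
    ultimately show "risk P dy net - empirical_risk m xs ys dy net - c_y =
        (\<Sum>k<dy. 2 * l2_norm (v k) * l2_norm (wbar k) * cos (\<theta>2 k) +
           (l2_norm (wbar k))\<^sup>2 * (\<Sum>j<N. \<mu> j * (cos (\<theta>1 k j))\<^sup>2))"
      unfolding gap by (intro sum.cong refl) simp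
  next
    have sym: "G $$ (a, b) = G $$ (b, a)" if "a < N" "b < N" for a b
      using that by (simp add: G_def mult.commute)
    \<comment> \<open>The bound is drawn from \<open>gap\<close> and not from the eigenvector
      expansion, so it depends on no choice of eigenvectors or angles.\<close>
    show "risk P dy net - empirical_risk m xs ys dy net - c_y
        \<le> (\<Sum>k<dy. 2 * l2_norm (v k) * l2_norm (wbar k) + lambda_max G * (l2_norm (wbar k))\<^sup>2)"
      unfolding gap
    proof (intro sum_mono add_mono)
      fix k
      show "2 * (v k \<bullet> wbar k) \<le> 2 * l2_norm (v k) * l2_norm (wbar k)"
        using scalar_prod_abs_le_l2_norm[OF v wbar, of k k] by simp
      show "wbar k \<bullet> (G *\<^sub>v wbar k) \<le> lambda_max G * (l2_norm (wbar k))\<^sup>2"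
        by (rule quadratic_form_le_lambda_max[OF G sym wbar])
    qed
  qed
qed

end
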